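(* The cofinality of the splitting number $\mathfrak s$ is not countable, i.e. $\operatorname{cf}(\mathfrak s)>\omega$.
   Context: For infinite $S\subseteq\omega$ and $Y\subseteq\omega$, $Y$ splits $S$ if both $S\cap Y$ and $S\setminus Y$ are infinite. A family $\mathcal Y\subseteq[\omega]^{\aleph_0}$ is a splitting family if every $S\in[\omega]^{\aleph_0}$ is split by some member of $\mathcal Y$. The splitting number $\mathfrak s$ is the minimum cardinality of a splitting family. *)

theory Defs
  imports Main "HOL-Library.Infinite_Set"
begin

unbundle cardinal_syntax

definition splits :: "nat set \<Rightarrow> nat set \<Rightarrow> bool" where
  "splits Y S \<longleftrightarrow> infinite (S \<inter> Y) \<and> infinite (S - Y)"

definition splitting_family :: "nat set set \<Rightarrow> bool" where
  "splitting_family F \<longleftrightarrow>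
     (\<forall>Y\<in>F. infinite Y) \<and> (\<forall>S. infinite S \<longrightarrow> (\<exists>Y\<in>F. splits Y S))"

text \<open>
  Cardinals are represented as in the BNF cardinal library, by well-orders satisfying
  \<open>Card_order\<close> and considered up to \<open>=o\<close>; \<open>|A|\<close> is the cardinality of \<open>A\<close>.
  The choice below is over sets of least cardinality, so for nonempty \<open>\<A>\<close> the
  result is the minimum of the cardinalities of the members of \<open>\<A>\<close>.
\<close>

definition min_card :: "'a set set \<Rightarrow> 'a rel" where
  "min_card \<A> = |SOME A. A \<in> \<A> \<and> (\<forall>B\<in>\<A>. |A| \<le>o |B| )|"

definition splitting_number :: "nat set rel" where
  "splitting_number = min_card {F. splitting_family F}"

text \<open>
  The library predicate \<open>cofinal\<close> uses strict upper bounds, which for orders without a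
  largest element (such as infinite cardinals) is the same as unboundedness.
\<close>

definition cofinality :: "'a rel \<Rightarrow> 'a rel" where
  "cofinality r = min_card {A. A \<subseteq> Field r \<and> cofinal A r}"

lemma min_card_attained:
  assumes "\<A> \<noteq> {}"
  obtains A where "A \<in> \<A>" "min_card \<A> = |A|" "\<forall>B\<in>\<A>. |A| \<le>o |B|"
proof -
  have "\<exists>r\<in>card_of ` \<A>. \<forall>r'\<in>card_of ` \<A>. r \<le>o r'"
    using assms by (intro exists_minim_Card_order) (auto simp: card_of_Card_order)
  then have "\<exists>A. A \<in> \<A> \<and> (\<forall>B\<in>\<A>. |A| \<le>o |B| )"
    by blast
  from someI_ex[OF this] show ?thesis
    using that unfolding min_card_def by blast
qed

lemma splitting_family_all_infinite: "splitting_family {Y. infinite Y}"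
proof -
  have "\<exists>Y. infinite Y \<and> splits Y S" if S: "infinite S" for S
  proof -
    obtain A B where AB: "A \<subseteq> S" "B \<subseteq> S" "infinite A" "infinite B" "A \<inter> B = {}"
      using infinite_split[OF S] by blast
    then have "S \<inter> A = A" "B \<subseteq> S - A"
      by auto
    with AB have "splits A S"
      unfolding splits_def using finite_subset by metis
    with AB(3) show ?thesis by blast
  qed
  then show ?thesis
    unfolding splitting_family_def by auto
qed

lemma splitting_number_attained:
  obtains F where "splitting_family F" "splitting_number = |F|"
    "\<And>G. splitting_family G \<Longrightarrow> |F| \<le>o |G|"
proof -
  have "{F. splitting_family F} \<noteq> {}"
    using splitting_family_all_infinite by blast
  then show thesis
    by (rule min_card_attained) (auto simp: splitting_number_def intro: that)
qed

lemma splitting_family_infinite: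
  assumes F: "splitting_family F"
  shows "infinite F"
proof
  assume "finite F"
  have "finite ((\<lambda>n. {Y \<in> F. n \<in> Y}) ` UNIV)"
    by (rule finite_subset[of _ "Pow F"]) (auto simp: \<open>finite F\<close>)
  then obtain n0 :: nat where n0: "infinite {n \<in> UNIV. {Y \<in> F. n \<in> Y} = {Y \<in> F. n0 \<in> Y}}"
    using pigeonhole_infinite[OF infinite_UNIV_nat] by blast
  define S where "S = {n. {Y \<in> F. n \<in> Y} = {Y \<in> F. n0 \<in> Y}}"
  have "infinite S"
    using n0 by (simp add: S_def)
  then obtain Y where Y: "Y \<in> F" "splits Y S"
    using F unfolding splitting_family_def by blast
  have "S \<inter> Y = {} \<or> S - Y = {}"
    using Y(1) unfolding S_def by blast
  with Y(2) show False
    unfolding splits_def by (metis finite.emptyI)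
qed

lemma cofinality_attained:
  assumes r: "Card_order r" and inf: "infinite (Field r)"
  obtains A where "A \<subseteq> Field r" "cofinal A r" "cofinality r = |A|"
    "\<And>B. B \<subseteq> Field r \<Longrightarrow> cofinal B r \<Longrightarrow> |A| \<le>o |B|"
proof -
  have "cofinal (Field r) r"
    unfolding cofinal_def using infinite_Card_order_limit[OF r inf] by blast
  then have "{A. A \<subseteq> Field r \<and> cofinal A r} \<noteq> {}"
    by blast
  then show thesis
    by (rule min_card_attained) (auto simp: cofinality_def intro: that)
qed

end

theory Submission
  imports Defs "HOL-Library.Diagonal_Subsequence"
begin

text \<open>
  A splitting family \<open>F\<close> is never a countable union of families \<open>G 0, G 1, \<dots>\<close> each of cardinality
  less than \<open>\<ss>\<close>.  Indeed, a family smaller than \<open>\<ss>\<close> fails to be splitting not only on \<open>\<omega>\<close> but, after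
  transporting it along an enumeration, on every infinite subset of \<open>\<omega>\<close>
  (\<open>small_family_subsequence\<close>).  One can therefore choose infinite sets
  \<open>S 0 \<supseteq> S 1 \<supseteq> \<dots>\<close> with \<open>S n\<close> unsplit by \<open>G n\<close>.  Being unsplit by a set passes to
  infinite sets that are almost contained in the given one, so an infinite pseudo-intersection of the
  \<open>S n\<close> is unsplit by every member of \<open>F\<close> (\<open>small_families_common_unsplit\<close>).

  If \<open>\<ss>\<close> had countable cofinality, a splitting family of cardinality \<open>\<ss>\<close>, well-ordered in type
  \<open>\<ss>\<close>, would decompose in this way: its proper initial segments are smaller than \<open>\<ss>\<close>, and those
  below the points of a countable cofinal set cover it.
\<close>

lemma splits_almost_mono:
  assumes "splits Y T" "finite (T - S)"
  shows "splits Y S"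
proof -
  have "T \<inter> Y \<subseteq> (S \<inter> Y) \<union> (T - S)" "T - Y \<subseteq> (S - Y) \<union> (T - S)"
    by auto
  with assms show ?thesis
    unfolding splits_def by (meson finite_UnI finite_subset)
qed

lemma splits_image:
  assumes "splits Y (f ` T)"
  shows "splits (f -` Y) T"
proof -
  have "f ` T \<inter> Y = f ` (T \<inter> f -` Y)" "f ` T - Y = f ` (T - f -` Y)"
    by auto
  with assms show ?thesis
    unfolding splits_def by (metis finite_imageI)
qed

text \<open>
  The preimages under \<open>s\<close> of the members of \<open>G\<close> form a family that is still too small to be
  splitting, and an infinite set unsplit by the preimages is carried by \<open>s\<close> to an infinite subset
  of \<open>range s\<close> unsplit by \<open>G\<close>.  Infinite sets are given as ranges of strictly increasing sequences
  to fit the diagonal argument below.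
\<close>

lemma small_family_subsequence:
  fixes s :: "nat \<Rightarrow> nat"
  assumes G: "|G| <o splitting_number"
  obtains r :: "nat \<Rightarrow> nat"
    where "strict_mono r" "\<And>Y. Y \<in> G \<Longrightarrow> \<not> splits Y (range (s \<circ> r))"
proof -
  \<comment> \<open>A splitting family must consist of infinite sets; a finite set splits nothing, so the finite
    preimages can be discarded.\<close>
  define H where "H = {Z \<in> (-`) s ` G. infinite Z}"
  obtain F where F: "splitting_number = |F|" "\<And>K. splitting_family K \<Longrightarrow> |F| \<le>o |K|"
    by (rule splitting_number_attained) blast
  have "|H| \<le>o |(-`) s ` G|"
    by (rule card_of_mono1) (auto simp: H_def)
  also have "|(-`) s ` G| \<le>o |G|"
    by (rule card_of_image)
  finally have "|H| <o |F|"
    using G unfolding F(1) by (rule ordLeq_ordLess_trans)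
  then have "\<not> splitting_family H"
    using F(2) not_ordLess_ordLeq by blast
  then obtain T where T: "infinite T" "\<And>Z. Z \<in> H \<Longrightarrow> \<not> splits Z T"
    unfolding splitting_family_def H_def by blast
  show thesis
  proof
    show "strict_mono (enumerate T)"
      using T(1) by (rule strict_mono_enumerate)
  next
    fix Y assume "Y \<in> G"
    show "\<not> splits Y (range (s \<circ> enumerate T))"
    proof
      assume "splits Y (range (s \<circ> enumerate T))"
      then have split: "splits (s -` Y) T"
        by (intro splits_image) (simp only: image_comp [symmetric] range_enumerate [OF T(1)])
      then have "infinite (s -` Y)"
        unfolding splits_def by (meson finite_Int)
      with \<open>Y \<in> G\<close> have "s -` Y \<in> H"
        by (simp add: H_def)
      with T(2) split show False by blast
    qed
  qed
qed

text \<open>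
  The diagonal sequence runs through a pseudo-intersection of the sets obtained by applying the
  previous lemma to \<open>G 0, G 1, \<dots>\<close> in turn: from index \<open>Suc n\<close> on it is a subsequence of the one
  that is unsplit by \<open>G n\<close>.
\<close>

lemma small_families_common_unsplit:
  fixes G :: "nat \<Rightarrow> nat set set"
  assumes G: "\<And>n. |G n| <o splitting_number"
  obtains T where "infinite T" "\<And>n Y. Y \<in> G n \<Longrightarrow> \<not> splits Y T"
proof -
  define P where "P n s \<longleftrightarrow> (\<forall>Y\<in>G n. \<not> splits Y (range s))" for n and s :: "nat \<Rightarrow> nat"
  interpret subseqs P
  proof
    fix n and s :: "nat \<Rightarrow> nat"
    obtain r :: "nat \<Rightarrow> nat"
      where "strict_mono r" "\<And>Y. Y \<in> G n \<Longrightarrow> \<not> splits Y (range (s \<circ> r))"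
      using small_family_subsequence[OF G] by blast
    then show "\<exists>r. strict_mono r \<and> P n (s \<circ> r)"
      unfolding P_def by blast
  qed
  show thesis
  proof
    show "infinite (range diagseq)"
      using subseq_diagseq by (intro range_inj_infinite strict_mono_imp_inj_on)
  next
    fix n Y assume "Y \<in> G n"
    have "P n (diagseq \<circ> (+) (Suc n))"
    proof (rule diagseq_holds)
      fix r s :: "nat \<Rightarrow> nat" and k
      assume "P k s"
      have "range (s \<circ> r) - range s = {}"
        by auto
      then have "finite (range (s \<circ> r) - range s)"
        by (simp only: finite.emptyI)
      with \<open>P k s\<close> show "P k (s \<circ> r)"
        unfolding P_def by (blast dest: splits_almost_mono)
    qed
    moreover have "range diagseq - range (diagseq \<circ> (+) (Suc n)) \<subseteq> diagseq ` {..n}"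
    proof
      fix x assume "x \<in> range diagseq - range (diagseq \<circ> (+) (Suc n))"
      then obtain i where i: "x = diagseq i" "\<And>j. x \<noteq> diagseq (Suc n + j)"
        by auto
      from i have "i \<le> n"
        by (metis le_Suc_ex not_less_eq_eq)
      with i(1) show "x \<in> diagseq ` {..n}"
        by blast
    qed
    then have "finite (range diagseq - range (diagseq \<circ> (+) (Suc n)))"
      by (rule finite_subset) simp
    ultimately show "\<not> splits Y (range diagseq)"
      using \<open>Y \<in> G n\<close> unfolding P_def by (blast dest: splits_almost_mono)
  qed
qed

theorem proposition1p1:
  shows "natLeq <o cofinality splitting_number"
proof (rule ccontr)
  assume not_less: "\<not> natLeq <o cofinality splitting_number"
  obtain F where F: "splitting_family F" "splitting_number = |F|"
    by (rule splitting_number_attained) blast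
  have Field_eq: "Field splitting_number = F"
    by (simp add: F(2) Field_card_of)
  have card: "Card_order splitting_number"
    unfolding F(2) by (rule card_of_Card_order)
  have inf: "infinite F"
    using F(1) by (rule splitting_family_infinite)
  obtain A where A: "A \<subseteq> F" "cofinal A splitting_number" "cofinality splitting_number = |A|"
    by (rule cofinality_attained[OF card]) (simp_all add: Field_eq inf)
  have "|A| \<le>o natLeq"
    using not_less unfolding A(3)
    by (simp add: not_ordLess_iff_ordLeq natLeq_Well_order card_of_Well_order)
  then have "|A| \<le>o |UNIV :: nat set|"
    by (rule ordLeq_ordIso_trans) (rule ordIso_symmetric[OF card_of_nat])
  moreover have "A \<noteq> {}"
    using A(2) inf unfolding cofinal_def Field_eq by (metis empty_iff equals0I finite.emptyI)
  ultimately obtain a :: "nat \<Rightarrow> nat set" where a: "range a = A"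
    by (auto simp flip: card_of_ordLeq2)
  have "|underS splitting_number (a n)| <o splitting_number" for n
    using card a A(1) Field_eq by (intro card_of_underS) auto
  then obtain T where T: "infinite T"
      "\<And>n Y. Y \<in> underS splitting_number (a n) \<Longrightarrow> \<not> splits Y T"
    using small_families_common_unsplit[of "\<lambda>n. underS splitting_number (a n)"] by blast
  from F(1) T(1) obtain Y where Y: "Y \<in> F" "splits Y T"
    unfolding splitting_family_def by blast
  from A(2) Y(1) obtain b where b: "b \<in> A" "Y \<in> underS splitting_number b"
    unfolding cofinal_def Field_eq underS_def by blast
  from b(1) a obtain n where "b = a n"
    by blast
  with T(2) Y(2) b(2) show False by blast
qed

end
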